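(* Let $X$ and $Y$ be non-trivial complex Banach spaces. Suppose that $(R(t))_{t>0}\subseteq L(X,Y)$ is a strongly continuous operator family and $\int_0^\infty\|R(s)\|_{L(X,Y)}\,ds<\infty$. If $f\in Q\text{-}AAP(\mathbb{R}:X)$, then the function $\mathbf{F}:\mathbb{R}\to Y$ defined by $\mathbf{F}(t):=\int_{-\infty}^tR(t-s)f(s)\,ds$, $t\in\mathbb{R}$, belongs to $Q\text{-}AAP(\mathbb{R}:Y)$.
   Context: $L(X,Y)$ is the space of continuous linear mappings from $X$ into $Y$. For $I=\mathbb{R}$ and a Banach space $Z$, $Q\text{-}AAP(I:Z)$ (quasi-asymptotically almost periodic functions) is the set of bounded continuous $f:I\to Z$ such that for each $\epsilon>0$ there exists a finite number $L(\epsilon)>0$ such that any interval $I'\subseteq I$ of length $L(\epsilon)$ contains at least one number $\tau\in I'$ for which there exists a finite number $M(\epsilon,\tau)>0$ with $\|f(t+\tau)-f(t)\|\le\epsilon$ for all $t\in I$ with $|t|\ge M(\epsilon,\tau)$. *)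

theory Defs
  imports "HOL-Analysis.Analysis"
begin

text \<open>Complex Banach spaces: real Banach spaces with a compatible complex scalar multiplication.
  No separability (second countability) is assumed.\<close>

class complex_banach = banach +
  fixes scaleC :: "complex \<Rightarrow> 'a \<Rightarrow> 'a"  (infixr "*\<^sub>C" 75)
  assumes scaleC_add_right: "c *\<^sub>C (x + y) = c *\<^sub>C x + c *\<^sub>C y"
    and scaleC_add_left: "(c + d) *\<^sub>C x = c *\<^sub>C x + d *\<^sub>C x"
    and scaleC_scaleC: "c *\<^sub>C (d *\<^sub>C x) = (c * d) *\<^sub>C x"
    and scaleC_of_real: "complex_of_real r *\<^sub>C x = r *\<^sub>R x"
    and norm_scaleC: "norm (c *\<^sub>C x) = cmod c * norm x"

instantiation complex :: complex_banach
begin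

definition scaleC_complex :: "complex \<Rightarrow> complex \<Rightarrow> complex" where
  "scaleC_complex c x = c * x"

instance
  by standard (auto simp: scaleC_complex_def algebra_simps norm_mult scaleR_conv_of_real)

end

text \<open>\<open>L(X,Y)\<close>: the type \<open>'a \<Rightarrow>\<^sub>L 'b\<close> consists of the bounded real-linear maps, so complex
  homogeneity is added. The inherited norm is the usual operator norm.\<close>

definition complex_blinfuns :: "('a::complex_banach \<Rightarrow>\<^sub>L 'b::complex_banach) set" where
  "complex_blinfuns = {T. \<forall>c x. blinfun_apply T (c *\<^sub>C x) = c *\<^sub>C blinfun_apply T x}"

text \<open>Strong continuity on \<open>(0,\<infinity>)\<close>; the values of \<open>R\<close> on \<open>(-\<infinity>,0]\<close> are irrelevant.\<close>

definition strongly_continuous :: "(real \<Rightarrow> 'a::complex_banach \<Rightarrow>\<^sub>L 'b::complex_banach) \<Rightarrow> bool" where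
  "strongly_continuous R \<longleftrightarrow> (\<forall>x. continuous_on {0<..} (\<lambda>t. blinfun_apply (R t) x))"

text \<open>The class \<open>Q-AAP(\<real>:Z)\<close>. Every interval of length \<open>L\<close> (open, closed or half-open) contains an
  open interval \<open>(a, a + L)\<close>, so it suffices to quantify over the latter.\<close>

definition Q_AAP :: "(real \<Rightarrow> 'a::complex_banach) set" where
  "Q_AAP = {f. continuous_on UNIV f \<and> bounded (range f) \<and>
     (\<forall>\<epsilon>>0. \<exists>L>0. \<forall>a. \<exists>\<tau>\<in>{a<..<a + L}. \<exists>M>0.
        \<forall>t. \<bar>t\<bar> \<ge> M \<longrightarrow> norm (f (t + \<tau>) - f t) \<le> \<epsilon>)}"

text \<open>\<open>\<integral>\<^bsub>-\<infinity>\<^esub>\<^bsup>t\<^esup> R(t - s) f(s) ds\<close>. The Henstock-Kurzweil integral is used because the library's Bochner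
  integral requires a second countable codomain. For a strongly continuous \<open>R\<close> and a continuous
  \<open>f\<close>, the integrand is continuous on \<open>(-\<infinity>,t)\<close>, and the two integrals agree as soon as
  the integral is absolutely convergent. The endpoint \<open>s = t\<close> is excluded because \<open>R(0)\<close> is not part of
  the family.\<close>

definition convolution_integrand ::
    "(real \<Rightarrow> 'a::complex_banach \<Rightarrow>\<^sub>L 'b::complex_banach) \<Rightarrow> (real \<Rightarrow> 'a) \<Rightarrow> real \<Rightarrow> real \<Rightarrow> 'b" where
  "convolution_integrand R f t s = blinfun_apply (R (t - s)) (f s)"

definition infinite_convolution ::
    "(real \<Rightarrow> 'a::complex_banach \<Rightarrow>\<^sub>L 'b::complex_banach) \<Rightarrow> (real \<Rightarrow> 'a) \<Rightarrow> real \<Rightarrow> 'b" where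
  "infinite_convolution R f t = integral {..<t} (convolution_integrand R f t)"

end

theory Submission
  imports Defs
begin

text \<open>Substituting \<open>s \<mapsto> t - s\<close> gives \<open>F(t) = \<integral>\<^bsub>0\<^esub>\<^bsup>\<infinity>\<^esup> R(s) f(t - s) ds\<close>, hence
  \<open>\<parallel>F(t + \<tau>) - F(t)\<parallel> \<le> \<integral>\<^bsub>0\<^esub>\<^bsup>\<infinity>\<^esup> \<parallel>R(s)\<parallel> \<parallel>f(t + \<tau> - s) - f(t - s)\<parallel> ds\<close>. The part \<open>s > N\<close> is small uniformly
  in \<open>t\<close> and \<open>\<tau>\<close> since \<open>f\<close> is bounded and \<open>\<parallel>R\<parallel>\<close> is integrable. On \<open>s \<le> N\<close> the increments of \<open>f\<close>
  are small either by uniform continuity on compact sets, which gives continuity of \<open>F\<close>, or because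
  \<open>\<bar>t\<bar> \<ge> M + N\<close> forces \<open>\<bar>t - s\<bar> \<ge> M\<close>, so that every \<open>\<tau>\<close> admissible for \<open>f\<close> is admissible for \<open>F\<close>.
  The integrand is continuous because \<open>R\<close> is locally bounded, by the uniform boundedness principle.\<close>

section \<open>The uniform boundedness principle\<close>

text \<open>Pointwise boundedness says that the closed sets \<open>E n\<close> cover the complete
  space, so by Baire's theorem one of them contains a ball. Differences of points of that ball
  control every direction, with a constant independent of \<open>i\<close>.\<close>

lemma banach_steinhaus:
  fixes T :: "'i \<Rightarrow> 'a::banach \<Rightarrow>\<^sub>L 'b::real_normed_vector"
  assumes "\<And>x. bounded ((\<lambda>i. T i x) ` I)"
  shows "bounded (T ` I)"
proof -
  define E where "E n = (\<Inter>i\<in>I. {x. norm (T i x) \<le> real n})" for n :: nat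
  have "closed (E n)" for n
    unfolding E_def by (intro closed_INT ballI closed_Collect_le continuous_intros)
  moreover have "\<Union> (range E) = UNIV"
  proof -
    have "\<exists>n. x \<in> E n" for x
    proof -
      obtain c where c: "norm (T i x) \<le> c" if "i \<in> I" for i
        using assms[of x] by (auto simp: bounded_iff)
      obtain n :: nat where "c \<le> real n"
        using real_arch_simple by blast
      with c have "x \<in> E n"
        by (auto simp: E_def intro: order_trans)
      then show ?thesis ..
    qed
    then show ?thesis by auto
  qed
  moreover have "Met_TC.mcomplete TYPE('a)"
    by (simp add: Met_TC.mcomplete_def Met_TC.MCauchy_def complete_UNIV)
  \<comment> \<open>If every \<open>E n\<close> had empty interior, so would their countable union,
    which is the whole space.\<close>
  ultimately obtain n where "interior (E n) \<noteq> {}"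
    using Met_TC.metric_Baire_category_alt[where ?'a = 'a, of "range E"] by auto
  then obtain x r where r: "r > 0" and ball: "ball x r \<subseteq> E n"
    by (meson ex_in_conv mem_interior)
  have "norm (T i) \<le> 4 * real n / r" if "i \<in> I" for i
  proof (rule norm_blinfun_bound)
    show "norm (T i y) \<le> 4 * real n / r * norm y" for y
    proof (cases "y = 0")
      case False
      \<comment> \<open>Rescaling \<open>y\<close> to norm \<open>r / 2\<close> keeps
        \<open>x + z\<close> in the ball. Then \<open>T i z\<close> is a difference of two vectors
        of norm at most \<open>n\<close>, and undoing the scaling turns \<open>2 * n\<close> into
        \<open>4 * n / r * norm y\<close>.\<close>
      define z where "z = (r / (2 * norm y)) *\<^sub>R y"
      have "norm z = r / 2"
        using r False by (simp add: z_def)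
      then have "x + z \<in> E n" "x \<in> E n"
        using r ball by (auto simp: dist_norm subset_iff)
      then have *: "norm (T i (x + z)) \<le> n" "norm (T i x) \<le> n"
        using that by (auto simp: E_def)
      have "T i z = T i (x + z) - T i x"
        by (simp add: blinfun.add_right)
      then have "norm (T i z) \<le> 2 * real n"
        using norm_triangle_ineq4[of "T i (x + z)" "T i x"] * by simp
      moreover have "norm (T i z) = r / (2 * norm y) * norm (T i y)"
        using r by (simp add: z_def blinfun.scaleR_right)
      ultimately show ?thesis
        using r False by (simp add: field_simps)
    qed simp
  qed (use r in simp)
  then show ?thesis
    by (auto simp: bounded_iff)
qed

section \<open>Integrability by approximation in the mean\<close>

lemma norm_diff_le_three:
  fixes u v p q :: "'a::real_normed_vector"
  shows "norm (u - v) \<le> norm (u - p) + norm (v - q) + norm (p - q)"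
proof -
  have "u - v = (u - p) - (v - q) + (p - q)" by simp
  also have "norm \<dots> \<le> norm (u - p) + norm (v - q) + norm (p - q)"
    by (intro norm_triangle_le add_right_mono norm_triangle_ineq4)
  finally show ?thesis .
qed

text \<open>The library's dominated convergence theorems need a Euclidean codomain. For Banach space
  values, approximation in \<open>L\<^sup>1\<close> can be fed directly into the Cauchy criterion for Riemann sums.\<close>

lemma integrable_on_cbox_approx:
  fixes F :: "'n::euclidean_space \<Rightarrow> 'a::banach"
  assumes "\<And>e. e > 0 \<Longrightarrow> \<exists>\<phi> h. \<phi> integrable_on cbox a b \<and> h integrable_on cbox a b \<and>
             integral (cbox a b) h \<le> e \<and> (\<forall>x\<in>cbox a b. norm (F x - \<phi> x) \<le> h x)"
  shows "F integrable_on cbox a b"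
  unfolding integrable_Cauchy
proof (intro allI impI)
  fix e :: real assume "e > 0"
  \<comment> \<open>Five shares: each of the two Riemann sums of \<open>F\<close> is within two
    shares of that of \<phi>, one for the integral of \<open>h\<close> and one for its Riemann sum,
    and the two sums of \<phi> differ by less than one share.\<close>
  then have e: "e / 5 > 0" by simp
  obtain \<phi> h where \<phi>: "\<phi> integrable_on cbox a b" and h: "h integrable_on cbox a b"
    and le: "integral (cbox a b) h \<le> e / 5" "\<And>x. x \<in> cbox a b \<Longrightarrow> norm (F x - \<phi> x) \<le> h x"
    using assms[OF e] by auto
  obtain \<gamma>1 where \<gamma>1: "gauge \<gamma>1" "\<And>\<D>1 \<D>2. \<D>1 tagged_division_of (cbox a b) \<Longrightarrow> \<gamma>1 fine \<D>1 \<Longrightarrow>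
            \<D>2 tagged_division_of (cbox a b) \<Longrightarrow> \<gamma>1 fine \<D>2 \<Longrightarrow>
            norm ((\<Sum>(x,K)\<in>\<D>1. measure lborel K *\<^sub>R \<phi> x) - (\<Sum>(x,K)\<in>\<D>2. measure lborel K *\<^sub>R \<phi> x)) < e / 5"
    using \<phi> e unfolding integrable_Cauchy by metis
  obtain \<gamma>2 where \<gamma>2: "gauge \<gamma>2" "\<And>\<D>. \<D> tagged_division_of (cbox a b) \<Longrightarrow> \<gamma>2 fine \<D> \<Longrightarrow>
            norm ((\<Sum>(x,K)\<in>\<D>. measure lborel K *\<^sub>R h x) - integral (cbox a b) h) < e / 5"
    using integrable_integral[OF h] e unfolding has_integral by metis
  have close: "norm ((\<Sum>(x,K)\<in>\<D>. measure lborel K *\<^sub>R F x) - (\<Sum>(x,K)\<in>\<D>. measure lborel K *\<^sub>R \<phi> x)) < 2 * (e / 5)"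
    if \<D>: "\<D> tagged_division_of (cbox a b)" "\<gamma>2 fine \<D>" for \<D>
  proof -
    have "(\<Sum>(x,K)\<in>\<D>. measure lborel K *\<^sub>R F x) - (\<Sum>(x,K)\<in>\<D>. measure lborel K *\<^sub>R \<phi> x)
        = (\<Sum>(x,K)\<in>\<D>. measure lborel K *\<^sub>R (F x - \<phi> x))"
      by (simp add: sum_subtractf scaleR_diff_right case_prod_unfold)
    also have "norm \<dots> \<le> (\<Sum>(x,K)\<in>\<D>. measure lborel K *\<^sub>R h x)"
    proof (rule sum_norm_le, clarify)
      fix x K assume "(x, K) \<in> \<D>"
      then have "x \<in> cbox a b"
        using \<D>(1) by blast
      then show "norm (measure lborel K *\<^sub>R (F x - \<phi> x)) \<le> measure lborel K *\<^sub>R h x"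
        using le(2) by (simp add: mult_left_mono)
    qed
    also have "\<dots> < 2 * (e / 5)"
      using \<gamma>2(2)[OF \<D>] le(1) unfolding real_norm_def abs_less_iff by linarith
    finally show ?thesis .
  qed
  show "\<exists>\<gamma>. gauge \<gamma> \<and>
          (\<forall>\<D>1 \<D>2. \<D>1 tagged_division_of (cbox a b) \<and> \<gamma> fine \<D>1 \<and>
            \<D>2 tagged_division_of (cbox a b) \<and> \<gamma> fine \<D>2 \<longrightarrow>
            norm ((\<Sum>(x,K)\<in>\<D>1. measure lborel K *\<^sub>R F x) - (\<Sum>(x,K)\<in>\<D>2. measure lborel K *\<^sub>R F x)) < e)"
  proof (intro exI conjI allI impI; (elim conjE)?)
    show "gauge (\<lambda>x. \<gamma>1 x \<inter> \<gamma>2 x)"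
      using \<gamma>1 \<gamma>2 by (simp add: gauge_Int)
    fix \<D>1 \<D>2
    assume \<D>: "\<D>1 tagged_division_of (cbox a b)" "\<D>2 tagged_division_of (cbox a b)"
      and "(\<lambda>x. \<gamma>1 x \<inter> \<gamma>2 x) fine \<D>1" "(\<lambda>x. \<gamma>1 x \<inter> \<gamma>2 x) fine \<D>2"
    then have fine: "\<gamma>1 fine \<D>1" "\<gamma>2 fine \<D>1" "\<gamma>1 fine \<D>2" "\<gamma>2 fine \<D>2"
      by (auto simp: fine_Int)
    show "norm ((\<Sum>(x,K)\<in>\<D>1. measure lborel K *\<^sub>R F x) - (\<Sum>(x,K)\<in>\<D>2. measure lborel K *\<^sub>R F x)) < e"
      using close[OF \<D>(1) fine(2)] close[OF \<D>(2) fine(4)] \<gamma>1(2)[OF \<D>(1) fine(1) \<D>(2) fine(3)]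
      by (intro le_less_trans[OF norm_diff_le_three[of _ _ "\<Sum>(x,K)\<in>\<D>1. measure lborel K *\<^sub>R \<phi> x"
            "\<Sum>(x,K)\<in>\<D>2. measure lborel K *\<^sub>R \<phi> x"]]) linarith
  qed
qed

text \<open>Integrability on \<open>S\<close> means that the extension by zero is integrable on
  every box and that the box integrals are Cauchy as the boxes grow. The first part is the box
  version of the statement; the second is inherited from \<phi>, because the error \<open>h\<close>
  has integral at most \<open>e\<close> on every box.\<close>

lemma integrable_on_approx:
  fixes F :: "'n::euclidean_space \<Rightarrow> 'a::banach"
  assumes approx: "\<And>e. e > 0 \<Longrightarrow> \<exists>\<phi> h. \<phi> integrable_on S \<and> h integrable_on S \<and>
             integral S h \<le> e \<and> (\<forall>x\<in>S. norm (F x - \<phi> x) \<le> h x)"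
  shows "F integrable_on S"
proof -
  define res where "res u x = (if x \<in> S then u x else 0)" for u :: "'n \<Rightarrow> 'a" and x
  define resr where "resr u x = (if x \<in> S then u x else 0)" for u :: "'n \<Rightarrow> real" and x
  have approx': "\<exists>\<phi> h. \<phi> integrable_on S \<and> (\<forall>a b. res \<phi> integrable_on cbox a b) \<and>
      (\<forall>a b. resr h integrable_on cbox a b \<and> integral (cbox a b) (resr h) \<le> e) \<and>
      (\<forall>x. norm (res F x - res \<phi> x) \<le> resr h x)" if e: "e > 0" for e
  proof -
    obtain \<phi> h where \<phi>: "\<phi> integrable_on S" and h: "h integrable_on S"
      and le: "integral S h \<le> e" "\<And>x. x \<in> S \<Longrightarrow> norm (F x - \<phi> x) \<le> h x"
      using approx[OF e] by auto
    \<comment> \<open>As \<open>h\<close> dominates a norm on \<open>S\<close>, it is nonnegative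
      there, so its integral over any box is at most the one over \<open>S\<close>.\<close>
    have nonneg: "resr h x \<ge> 0" for x
      using le(2)[of x] norm_ge_zero[of "F x - \<phi> x"] by (auto simp: resr_def simp del: norm_ge_zero)
    have int: "resr h integrable_on UNIV" "integral UNIV (resr h) = integral S h"
      using h unfolding resr_def[abs_def]
      by (simp_all add: integrable_restrict_UNIV integral_restrict_UNIV)
    have box: "resr h integrable_on cbox a b" for a b
      using int(1) integrable_on_subcbox by blast
    have "integral (cbox a b) (resr h) \<le> e" for a b
      using integral_subset_le[OF _ box int(1), of a b] nonneg int(2) le(1) by auto
    moreover have "res \<phi> integrable_on cbox a b" for a b
      using \<phi> integrable_altD(1) unfolding res_def[abs_def] by blast
    moreover have "norm (res F x - res \<phi> x) \<le> resr h x" for x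
      using le(2) by (simp add: res_def resr_def)
    ultimately show ?thesis
      using \<phi> box by blast
  qed
  have box: "res F integrable_on cbox a b" for a b
  proof (rule integrable_on_cbox_approx)
    fix e :: real assume "e > 0"
    from approx'[OF this] show "\<exists>\<phi> h. \<phi> integrable_on cbox a b \<and> h integrable_on cbox a b \<and>
             integral (cbox a b) h \<le> e \<and> (\<forall>x\<in>cbox a b. norm (res F x - \<phi> x) \<le> h x)"
      by blast
  qed
  have "\<exists>B>0. \<forall>a b c d. ball 0 B \<subseteq> cbox a b \<and> ball 0 B \<subseteq> cbox c d \<longrightarrow>
      norm (integral (cbox a b) (res F) - integral (cbox c d) (res F)) < e" if "e > 0" for e
  proof -
    have e: "e / 4 > 0" using that by simp
    obtain \<phi> h where \<phi>: "\<phi> integrable_on S" "\<And>a b. res \<phi> integrable_on cbox a b"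
      and h: "\<And>a b. resr h integrable_on cbox a b"
      and le: "\<And>a b. integral (cbox a b) (resr h) \<le> e / 4" "\<And>x. norm (res F x - res \<phi> x) \<le> resr h x"
      using approx'[OF e] by blast
    obtain B where B: "B > 0" "\<And>a b c d. ball 0 B \<subseteq> cbox a b \<Longrightarrow> ball 0 B \<subseteq> cbox c d \<Longrightarrow>
        norm (integral (cbox a b) (res \<phi>) - integral (cbox c d) (res \<phi>)) < e / 4"
      using integrable_altD(2)[OF \<phi>(1) e] unfolding res_def[abs_def] by blast
    have close: "norm (integral (cbox a b) (res F) - integral (cbox a b) (res \<phi>)) \<le> e / 4" for a b
    proof -
      have "norm (integral (cbox a b) (\<lambda>x. res F x - res \<phi> x)) \<le> integral (cbox a b) (resr h)"
        by (intro integral_norm_bound_integral integrable_diff box \<phi> h le(2))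
      then show ?thesis
        using le(1)[of a b] by (simp add: integral_diff box \<phi>)
    qed
    have "norm (integral (cbox a b) (res F) - integral (cbox c d) (res F)) < e"
      if "ball 0 B \<subseteq> cbox a b" "ball 0 B \<subseteq> cbox c d" for a b c d
      using norm_diff_le_three[of "integral (cbox a b) (res F)" "integral (cbox c d) (res F)"
          "integral (cbox a b) (res \<phi>)" "integral (cbox c d) (res \<phi>)"]
        close[of a b] close[of c d] B(2)[OF that] e
      by linarith
    then show ?thesis
      using B(1) by blast
  qed
  then show ?thesis
    using box unfolding integrable_alt[of F] res_def[abs_def] by blast
qed

section \<open>Dominated integrability on an open half-line\<close>

text \<open>The compact intervals \<open>K n\<close> exhaust the half-line, so \<open>g\<close> set
  to zero on \<open>K n\<close> tends to zero pointwise, dominated by \<open>g\<close>. Mass is cut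
  off near \<open>a\<close> as well as near infinity, since the functions considered later may be
  singular at the open end.\<close>

lemma integral_Ioi_outside_Icc_small:
  fixes g :: "real \<Rightarrow> real"
  assumes g: "g integrable_on {a<..}" and nonneg: "\<And>x. x > a \<Longrightarrow> g x \<ge> 0" and e: "e > 0"
  obtains b c where "a < b" "b \<le> c" "(\<lambda>x. if x \<in> {b..c} then 0 else g x) integrable_on {a<..}"
    "integral {a<..} (\<lambda>x. if x \<in> {b..c} then 0 else g x) \<le> e"
proof -
  define K where "K n = {a + 1 / real (Suc n) .. a + real (Suc n)}" for n
  define h where "h n x = (if x \<in> K n then 0 else g x)" for n x
  have K: "K n \<subseteq> {a<..}" for n
  proof
    fix x assume "x \<in> K n"
    then have "a + 1 / real (Suc n) \<le> x" by (simp add: K_def)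
    moreover have "1 / real (Suc n) > 0" by simp
    ultimately show "x \<in> {a<..}" unfolding greaterThan_iff by linarith
  qed
  have gK: "g integrable_on K n" for n
    using integrable_on_subinterval[OF g] K unfolding K_def by blast
  have "(\<lambda>x. if x \<in> K n then g x else 0) integrable_on {a<..}" for n
    using gK[of n] integrable_restrict_Int[of "K n" g "{a<..}"] K[of n] by (simp add: Int_absorb2)
  from integrable_diff[OF g this] have h: "h n integrable_on {a<..}" for n
    by (rule integrable_eq) (auto simp: h_def)
  have "(\<lambda>n. integral {a<..} (h n)) \<longlonglongrightarrow> integral {a<..} (\<lambda>x. 0)"
  proof (rule dominated_convergence(2)[OF h g])
    show "norm (h n x) \<le> g x" if "x \<in> {a<..}" for n x
      using nonneg that by (auto simp: h_def)
    fix x assume x: "x \<in> {a<..}"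
    have "((\<lambda>n. a + 1 / real (Suc n)) \<longlongrightarrow> a) sequentially"
      using tendsto_add[OF tendsto_const LIMSEQ_Suc[OF lim_1_over_n], of a] by simp
    then have "\<forall>\<^sub>F n in sequentially. a + 1 / real (Suc n) < x"
      using x order_tendstoD(2) by fastforce
    moreover have "\<forall>\<^sub>F n in sequentially. x - a < real (Suc n)"
      using filterlim_compose[OF filterlim_real_sequentially filterlim_Suc]
      by (simp add: filterlim_at_top_dense)
    ultimately have "\<forall>\<^sub>F n in sequentially. h n x = 0"
      by eventually_elim (auto simp: h_def K_def)
    then show "(\<lambda>n. h n x) \<longlonglongrightarrow> 0"
      by (rule tendsto_eventually)
  qed
  then have "(\<lambda>n. integral {a<..} (h n)) \<longlonglongrightarrow> 0" by simp
  from eventually_happens'[OF _ order_tendstoD(2)[OF this e]]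
  obtain n where n: "integral {a<..} (h n) < e" by auto
  \<comment> \<open>This is \<open>b \<le> c\<close>; using \<open>Suc n\<close> makes it hold
    already for \<open>n = 0\<close>.\<close>
  have "1 / real (Suc n) \<le> real (Suc n)" by (simp add: field_simps)
  then show ?thesis
    using that[of "a + 1 / real (Suc n)" "a + real (Suc n)"] h[of n] n
    by (simp add: h_def[abs_def] K_def)
qed

text \<open>Cutting \<open>F\<close> off outside a compact \<open>{b..c}\<close> leaves a function
  that is integrable by continuity, and the error is dominated by \<open>g\<close> outside
  \<open>{b..c}\<close>, whose integral is small.\<close>

lemma integrable_on_Ioi_dominated:
  fixes F :: "real \<Rightarrow> 'a::banach"
  assumes cont: "continuous_on {a<..} F" and g: "g integrable_on {a<..}"
    and le: "\<And>x. x > a \<Longrightarrow> norm (F x) \<le> g x"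
  shows "F integrable_on {a<..}"
proof (rule integrable_on_approx)
  fix e :: real assume e: "e > 0"
  have "g x \<ge> 0" if "x > a" for x
    using le[OF that] norm_ge_zero order_trans by blast
  from integral_Ioi_outside_Icc_small[OF g this e]
  obtain b c where bc: "a < b" "b \<le> c"
    and h: "(\<lambda>x. if x \<in> {b..c} then 0 else g x) integrable_on {a<..}"
      "integral {a<..} (\<lambda>x. if x \<in> {b..c} then 0 else g x) \<le> e"
    by blast
  define \<phi> where "\<phi> x = (if x \<in> {b..c} then F x else 0)" for x
  have K: "{b..c} \<subseteq> {a<..}" using bc by auto
  have "F integrable_on {b..c}"
    using continuous_on_subset[OF cont K] by (rule integrable_continuous_interval)
  then have "\<phi> integrable_on {a<..}"
    using integrable_restrict_Int[of "{b..c}" F "{a<..}"] K unfolding \<phi>_def[abs_def]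
    by (simp add: Int_absorb2)
  moreover have "norm (F x - \<phi> x) \<le> (if x \<in> {b..c} then 0 else g x)" if "x \<in> {a<..}" for x
    using le that by (auto simp: \<phi>_def)
  ultimately show "\<exists>\<phi> h. \<phi> integrable_on {a<..} \<and> h integrable_on {a<..} \<and>
      integral {a<..} h \<le> e \<and> (\<forall>x\<in>{a<..}. norm (F x - \<phi> x) \<le> h x)"
    using h by blast
qed

section \<open>The substitution \<open>s \<mapsto> t - s\<close>\<close>

lemma has_integral_reflect_shift:
  fixes F :: "real \<Rightarrow> 'a::banach"
  assumes "(F has_integral I) S"
  shows "((\<lambda>s. F (t - s)) has_integral I) {s. t - s \<in> S}"
  unfolding has_integral'[of _ I "{s. t - s \<in> S}"]
proof (intro allI impI)
  fix e :: real assume "e > 0"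
  then obtain B where B: "B > 0" "\<And>a b. ball 0 B \<subseteq> cbox a b \<Longrightarrow>
      \<exists>z. ((\<lambda>x. if x \<in> S then F x else 0) has_integral z) (cbox a b) \<and> norm (z - I) < e"
    using assms unfolding has_integral'[of F I S] by metis
  show "\<exists>B>0. \<forall>a b. ball 0 B \<subseteq> cbox a b \<longrightarrow> (\<exists>z.
      ((\<lambda>x. if x \<in> {s. t - s \<in> S} then F (t - x) else 0) has_integral z) (cbox a b) \<and> norm (z - I) < e)"
  \<comment> \<open>Reflection moves the centre of the ball from \<open>0\<close> to
    \<open>t\<close>; the extra radius \<open>\<bar>t\<bar>\<close> ensures that the reflected box
    still contains \<open>ball 0 B\<close>.\<close>
  proof (intro exI[of _ "B + \<bar>t\<bar>"] conjI allI impI)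
    show "B + \<bar>t\<bar> > 0" using B(1) by simp
    fix a b :: real assume sub: "ball 0 (B + \<bar>t\<bar>) \<subseteq> cbox a b"
    have "ball 0 B \<subseteq> cbox (t - b) (t - a)"
    proof
      fix x :: real assume "x \<in> ball 0 B"
      then have "t - x \<in> ball 0 (B + \<bar>t\<bar>)" by (simp add: dist_norm)
      then have "t - x \<in> cbox a b" using sub by blast
      then show "x \<in> cbox (t - b) (t - a)" by auto
    qed
    then obtain z where z: "((\<lambda>x. if x \<in> S then F x else 0) has_integral z) (cbox (t - b) (t - a))"
      "norm (z - I) < e"
      using B(2) by blast
    have "((\<lambda>x. if t - x \<in> S then F (t - x) else 0) has_integral z) (cbox a b)"
      using has_integral_affinity[OF z(1), of "-1" t] by (auto cong: if_cong)
    then show "\<exists>z. ((\<lambda>x. if x \<in> {s. t - s \<in> S} then F (t - x) else 0) has_integral z) (cbox a b)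
        \<and> norm (z - I) < e"
      using z(2) by auto
  qed
qed

section \<open>Regularity of strongly continuous operator families\<close>

lemma strongly_continuous_bounded_on_compact:
  assumes "strongly_continuous R" and "compact K" and "K \<subseteq> {0<..}"
  shows "bounded (R ` K)"
proof (rule banach_steinhaus)
  show "bounded ((\<lambda>t. blinfun_apply (R t) x) ` K)" for x
    using assms unfolding strongly_continuous_def
    by (meson compact_continuous_image compact_imp_bounded continuous_on_subset)
qed

text \<open>Split \<open>R r (u r)\<close> as \<open>R r (u r - u s) + R r (u s)\<close>. Strong
  continuity handles the second term; the first tends to zero because \<open>norm (R r)\<close>
  stays bounded for \<open>r\<close> near \<open>s\<close>.\<close>

lemma strongly_continuous_apply:
  assumes R: "strongly_continuous R" and u: "continuous_on {0<..} u"
  shows "continuous_on {0<..} (\<lambda>s. blinfun_apply (R s) (u s))"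
  unfolding continuous_on_eq_continuous_at[OF open_greaterThan]
proof
  fix s :: real assume "s \<in> {0<..}"
  then have s: "s > 0" by simp
  \<comment> \<open>A compact neighbourhood of \<open>s\<close> that avoids
    \<open>0\<close>.\<close>
  have "compact {s / 2 .. 2 * s}" "{s / 2 .. 2 * s} \<subseteq> {0<..}" using s by auto
  from strongly_continuous_bounded_on_compact[OF R this]
  obtain C where C: "norm (R r) \<le> C" if "r \<in> {s / 2 .. 2 * s}" for r
    unfolding bounded_iff by blast
  have Rs: "((\<lambda>r. R r (u s)) \<longlongrightarrow> R s (u s)) (at s)"
    using R s unfolding strongly_continuous_def continuous_on_eq_continuous_at[OF open_greaterThan]
    by (auto simp: isCont_def)
  have us: "(u \<longlongrightarrow> u s) (at s)"
    using u s unfolding continuous_on_eq_continuous_at[OF open_greaterThan] by (auto simp: isCont_def)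
  have "((\<lambda>r. R r (u r - u s)) \<longlongrightarrow> 0) (at s)"
  proof (rule Lim_null_comparison)
    show "((\<lambda>r. C * norm (u r - u s)) \<longlongrightarrow> 0) (at s)"
      using us by (auto intro!: tendsto_eq_intros)
    have "\<forall>\<^sub>F r in at s. r \<in> {s / 2 <..< 2 * s}"
      using s by (intro eventually_at_in_open') auto
    then show "\<forall>\<^sub>F r in at s. norm (R r (u r - u s)) \<le> C * norm (u r - u s)"
    proof eventually_elim
      case (elim r)
      then have "norm (R r) * norm (u r - u s) \<le> C * norm (u r - u s)"
        using C[of r] by (intro mult_right_mono) auto
      then show ?case
        using norm_blinfun[of "R r" "u r - u s"] by linarith
    qed
  qed
  from tendsto_add[OF this Rs] show "isCont (\<lambda>s. R s (u s)) s"
    by (simp add: isCont_def blinfun.diff_right)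
qed

text \<open>The operator norm is only lower semicontinuous, as a supremum of the continuous
  functions \<open>t \<mapsto> \<parallel>R(t) x\<parallel>\<close>.\<close>

lemma borel_measurable_norm_strongly_continuous:
  assumes "strongly_continuous R"
  shows "(\<lambda>s. indicator {0<..} s * norm (R s)) \<in> borel_measurable borel"
proof (subst borel_measurable_iff_greater, clarify)
  fix c :: real
  show "{s \<in> space borel. c < indicator {0<..} s * norm (R s)} \<in> sets borel"
  proof (cases "c < 0")
    case True
    then have "{s \<in> space borel. c < indicator {0<..} s * norm (R s)} = UNIV"
      by (auto simp: indicator_def intro: less_le_trans)
    then show ?thesis by simp
  next
    case False
    \<comment> \<open>The union may be uncountable, so measurability of its members would not
      suffice; it is Borel because each member is open. Here \<open>c \<ge> 0\<close> excludes all
      \<open>s \<le> 0\<close> and makes \<open>c\<close> eligible as an operator norm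
      bound.\<close>
    have "{s \<in> space borel. c < indicator {0<..} s * norm (R s)}
        = (\<Union>x. {s \<in> {0<..}. c * norm x < norm (R s x)})"
    proof -
      have "c < norm T \<longleftrightarrow> (\<exists>x. c * norm x < norm (blinfun_apply T x))" for T :: "'a \<Rightarrow>\<^sub>L 'b"
      proof
        show "c < norm T \<Longrightarrow> \<exists>x. c * norm x < norm (blinfun_apply T x)"
          by (meson False norm_blinfun_bound not_le)
        assume "\<exists>x. c * norm x < norm (blinfun_apply T x)"
        then obtain x where "c * norm x < norm (blinfun_apply T x)" ..
        also have "\<dots> \<le> norm T * norm x" by (rule norm_blinfun)
        finally show "c < norm T" by (simp add: mult_less_cancel_right)
      qed
      then show ?thesis
        using False by (auto simp: indicator_def split: if_splits)
    qed
    moreover have "open {s \<in> {0<..}. c * norm x < norm (R s x)}" for x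
    proof -
      have "continuous_on {0<..} (\<lambda>s. norm (R s x))"
        using assms by (auto simp: strongly_continuous_def intro: continuous_on_norm)
      then have "open ({0<..} \<inter> (\<lambda>s. norm (R s x)) -` {c * norm x<..})"
        by (intro continuous_open_preimage) auto
      also have "{0<..} \<inter> (\<lambda>s. norm (R s x)) -` {c * norm x<..} = {s \<in> {0<..}. c * norm x < norm (R s x)}"
        by auto
      finally show ?thesis .
    qed
    ultimately show ?thesis
      by (metis (no_types, lifting) UNIV_I borel_open open_UN)
  qed
qed

text \<open>Translates the Lebesgue hypothesis on the operator norm into gauge integrability, the
  form used from here on.\<close>

lemma norm_strongly_continuous_integrable_on:
  assumes "strongly_continuous R"
    and "(\<integral>\<^sup>+ s\<in>{0<..}. ennreal (norm (R s)) \<partial>lborel) < \<infinity>"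
  shows "(\<lambda>s. norm (R s)) integrable_on {0<..}"
proof -
  have "(\<integral>\<^sup>+ s. ennreal (indicator {0<..} s * norm (R s)) \<partial>lborel)
      = (\<integral>\<^sup>+ s\<in>{0<..}. ennreal (norm (R s)) \<partial>lborel)"
    by (rule nn_integral_cong) (simp add: indicator_def)
  then have "(\<lambda>s. indicator {0<..} s * norm (R s)) integrable_on UNIV"
    using borel_measurable_norm_strongly_continuous[OF assms(1)] assms(2)
    by (intro nn_integral_integrable_on) auto
  then have "(\<lambda>s. if s \<in> {0<..} then norm (R s) else 0) integrable_on UNIV"
    by (rule integrable_eq) simp
  then show ?thesis
    by (simp only: integrable_restrict_UNIV)
qed

section \<open>The convolution integral and its increments\<close>

text \<open>Both integrands are continuous and dominated by \<open>norm (R s) * C\<close>. The norm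
  is treated separately because gauge integrability alone does not give absolute
  integrability.\<close>

lemma kernel_apply_integrable_on:
  assumes R: "strongly_continuous R" and int: "(\<lambda>s. norm (R s)) integrable_on {0<..}"
    and u: "continuous_on {0<..} u" and C: "\<And>s. s > 0 \<Longrightarrow> norm (u s) \<le> C"
  shows "(\<lambda>s. blinfun_apply (R s) (u s)) integrable_on {0<..}"
    and "(\<lambda>s. norm (blinfun_apply (R s) (u s))) integrable_on {0<..}"
proof -
  note cont = strongly_continuous_apply[OF R u]
  have g: "(\<lambda>s. norm (R s) * C) integrable_on {0<..}"
    using int by (rule integrable_on_mult_left)
  have le: "norm (R s (u s)) \<le> norm (R s) * C" if "s > 0" for s
    using norm_blinfun[of "R s" "u s"] mult_left_mono[OF C[OF that] norm_ge_zero[of "R s"]] by linarith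
  show "(\<lambda>s. R s (u s)) integrable_on {0<..}"
    by (rule integrable_on_Ioi_dominated[OF cont g le])
  show "(\<lambda>s. norm (R s (u s))) integrable_on {0<..}"
    by (rule integrable_on_Ioi_dominated[OF continuous_on_norm[OF cont] g]) (use le in auto)
qed

text \<open>On the fixed domain \<open>{0<..}\<close>, values of the convolution at different
  \<open>t\<close> can be subtracted under one integral.\<close>

lemma infinite_convolution_kernel_form:
  assumes R: "strongly_continuous R" and int: "(\<lambda>s. norm (R s)) integrable_on {0<..}"
    and f: "continuous_on UNIV f" and C: "\<And>s. norm (f s) \<le> C"
  shows "(\<lambda>s. blinfun_apply (R s) (f (t - s))) integrable_on {0<..}"
    and "convolution_integrand R f t integrable_on {..<t}"
    and "(\<lambda>s. norm (convolution_integrand R f t s)) integrable_on {..<t}"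
    and "infinite_convolution R f t = integral {0<..} (\<lambda>s. blinfun_apply (R s) (f (t - s)))"
proof -
  have "continuous_on {0<..} (\<lambda>s. f (t - s))"
    by (rule continuous_on_compose2[OF f]) (auto intro!: continuous_intros)
  note ker = kernel_apply_integrable_on[OF R int this C]
  show "(\<lambda>s. blinfun_apply (R s) (f (t - s))) integrable_on {0<..}" by (rule ker)
  have set_eq: "{s. t - s \<in> {0<..}} = {..<t}" by auto
  have "(convolution_integrand R f t has_integral integral {0<..} (\<lambda>s. R s (f (t - s)))) {..<t}"
    using has_integral_reflect_shift[OF integrable_integral[OF ker(1)], of t]
    unfolding set_eq by (simp add: convolution_integrand_def[abs_def])
  then show "convolution_integrand R f t integrable_on {..<t}"
    "infinite_convolution R f t = integral {0<..} (\<lambda>s. blinfun_apply (R s) (f (t - s)))"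
    unfolding infinite_convolution_def by (auto simp: integral_unique)
  show "(\<lambda>s. norm (convolution_integrand R f t s)) integrable_on {..<t}"
    using has_integral_reflect_shift[OF integrable_integral[OF ker(2)], of t]
    unfolding set_eq by (auto simp: convolution_integrand_def[abs_def])
qed

text \<open>The common core of continuity and quasi-asymptotic almost periodicity: \<open>N\<close>
  and \<delta> do not depend on \<open>t\<close> and \<tau>, so only increments of \<open>f\<close>
  on a window of length \<open>N\<close> have to be controlled.\<close>

lemma infinite_convolution_diff_small:
  assumes R: "strongly_continuous R" and int: "(\<lambda>s. norm (R s)) integrable_on {0<..}"
    and f: "continuous_on UNIV f" and C: "\<And>s. norm (f s) \<le> C" and e: "e > 0"
  obtains N \<delta> where "N > 0" "\<delta> > 0"
    "\<And>t \<tau>. (\<And>s. 0 < s \<Longrightarrow> s \<le> N \<Longrightarrow> norm (f (t - s + \<tau>) - f (t - s)) \<le> \<delta>) \<Longrightarrow>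
      norm (infinite_convolution R f (t + \<tau>) - infinite_convolution R f t) \<le> e"
proof -
  note form = infinite_convolution_kernel_form[OF R int f C]
  define G where "G = integral {0<..} (\<lambda>s. norm (R s))"
  have G: "G \<ge> 0" unfolding G_def by (intro integral_nonneg int) simp
  have C0: "C \<ge> 0" using C[of 0] norm_ge_zero order_trans by blast
  \<comment> \<open>Outside \<open>{b..N}\<close> increments of \<open>f\<close> are at most
    \<open>2 * C\<close>, so this bound on the remaining mass of \<open>norm (R s)\<close> costs at
    most \<open>e / 2\<close>; the \<open>+ 1\<close> avoids division by zero.\<close>
  have "e / (4 * (C + 1)) > 0" using e C0 by simp
  from integral_Ioi_outside_Icc_small[OF int norm_ge_zero this] obtain b N where bN: "0 < b" "b \<le> N"
    and small: "(\<lambda>s. if s \<in> {b..N} then 0 else norm (R s)) integrable_on {0<..}"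
      "integral {0<..} (\<lambda>s. if s \<in> {b..N} then 0 else norm (R s)) \<le> e / (4 * (C + 1))" .
  define h where "h = (\<lambda>s. if s \<in> {b..N} then 0 else norm (R s))"
  note h = small[folded h_def]
  define \<delta> where "\<delta> = e / (2 * (G + 1))"
  have \<delta>: "\<delta> > 0" using e G by (simp add: \<delta>_def)
  have "norm (infinite_convolution R f (t + \<tau>) - infinite_convolution R f t) \<le> e"
    if close: "\<And>s. 0 < s \<Longrightarrow> s \<le> N \<Longrightarrow> norm (f (t - s + \<tau>) - f (t - s)) \<le> \<delta>" for t \<tau>
  proof -
    have "infinite_convolution R f (t + \<tau>) - infinite_convolution R f t
        = integral {0<..} (\<lambda>s. R s (f (t + \<tau> - s)) - R s (f (t - s)))"
      unfolding form(4) by (rule integral_diff[symmetric]) (rule form(1))+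
    \<comment> \<open>The first summand bounds the integrand on \<open>{b..N}\<close>, the second
      bounds it elsewhere; both are nonnegative.\<close>
    also have "norm \<dots> \<le> integral {0<..} (\<lambda>s. norm (R s) * \<delta> + h s * (2 * C))"
    proof (rule integral_norm_bound_integral)
      show "(\<lambda>s. R s (f (t + \<tau> - s)) - R s (f (t - s))) integrable_on {0<..}"
        by (intro integrable_diff form(1))
      show "(\<lambda>s. norm (R s) * \<delta> + h s * (2 * C)) integrable_on {0<..}"
        by (intro integrable_add integrable_on_mult_left int h(1))
      fix s :: real assume s: "s \<in> {0<..}"
      let ?d = "f (t - s + \<tau>) - f (t - s)"
      have "R s (f (t + \<tau> - s)) - R s (f (t - s)) = R s ?d"
        by (simp add: blinfun.diff_right algebra_simps)
      moreover have "norm (R s ?d) \<le> norm (R s) * norm ?d"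
        by (rule norm_blinfun)
      moreover have "norm (R s) * norm ?d \<le> norm (R s) * \<delta> + h s * (2 * C)"
      proof (cases "s \<in> {b..N}")
        case True
        then show ?thesis
          using mult_left_mono[OF close[of s] norm_ge_zero[of "R s"]] s by (simp add: h_def)
      next
        case False
        have "norm ?d \<le> 2 * C"
          using norm_triangle_ineq4[of "f (t - s + \<tau>)" "f (t - s)"] C[of "t - s + \<tau>"] C[of "t - s"]
          by linarith
        then have "norm (R s) * norm ?d \<le> norm (R s) * (2 * C)"
          by (rule mult_left_mono) simp
        moreover have "0 \<le> norm (R s) * \<delta>"
          using \<delta> by simp
        moreover have "h s = norm (R s)"
          using False unfolding h_def by (rule if_not_P)
        ultimately show ?thesis by simp
      qed
      ultimately show "norm (R s (f (t + \<tau> - s)) - R s (f (t - s))) \<le> norm (R s) * \<delta> + h s * (2 * C)"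
        by simp
    qed
    also have "\<dots> = G * \<delta> + integral {0<..} h * (2 * C)"
      by (simp add: G_def integral_add integrable_on_mult_left int h(1))
    also have "\<dots> \<le> e / 2 + e / 2"
    proof (rule add_mono)
      show "G * \<delta> \<le> e / 2"
        using G e by (simp add: \<delta>_def field_simps)
      have "integral {0<..} h * (2 * C) \<le> e / (4 * (C + 1)) * (2 * C)"
        using h(2) C0 by (intro mult_right_mono) auto
      also have "\<dots> \<le> e / 2"
        using C0 e by (simp add: field_simps)
      finally show "integral {0<..} h * (2 * C) \<le> e / 2" .
    qed
    finally show ?thesis by simp
  qed
  then show ?thesis
    using that[of N \<delta>] bN \<delta> by simp
qed

section \<open>Continuity, boundedness and almost periods of the convolution\<close>

theorem proposition3p2:
  fixes R :: "real \<Rightarrow> 'a::complex_banach \<Rightarrow>\<^sub>L 'b::complex_banach"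
    and f :: "real \<Rightarrow> 'a"
  assumes "\<exists>x::'a. x \<noteq> 0" and "\<exists>y::'b. y \<noteq> 0"
    and "\<And>t. t > 0 \<Longrightarrow> R t \<in> complex_blinfuns"
    and "strongly_continuous R"
    and "(\<integral>\<^sup>+ s\<in>{0<..}. ennreal (norm (R s)) \<partial>lborel) < \<infinity>"
    and "f \<in> Q_AAP"
  shows "(\<forall>t. convolution_integrand R f t integrable_on {..<t} \<and>
              (\<lambda>s. norm (convolution_integrand R f t s)) integrable_on {..<t}) \<and>
         infinite_convolution R f \<in> Q_AAP"
proof -
  note R = assms(4)
  have int: "(\<lambda>s. norm (R s)) integrable_on {0<..}"
    by (rule norm_strongly_continuous_integrable_on[OF assms(4,5)])
  have f: "continuous_on UNIV f" and "bounded (range f)"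
    and aap: "\<And>\<epsilon>. \<epsilon> > 0 \<Longrightarrow> \<exists>L>0. \<forall>a. \<exists>\<tau>\<in>{a<..<a + L}. \<exists>M>0.
        \<forall>t. \<bar>t\<bar> \<ge> M \<longrightarrow> norm (f (t + \<tau>) - f t) \<le> \<epsilon>"
    using assms(6) by (auto simp: Q_AAP_def)
  then obtain C where C: "\<And>s. norm (f s) \<le> C"
    by (auto simp: bounded_iff)
  note form = infinite_convolution_kernel_form[OF R int f C]
  note small = infinite_convolution_diff_small[OF R int f C]
  let ?F = "infinite_convolution R f"
  have "continuous_on UNIV ?F"
  proof (intro continuous_at_imp_continuous_on ballI, unfold continuous_at_eps_delta, intro allI impI)
    fix t e :: real assume "e > 0"
    then have "e / 2 > 0" by simp
    from small[OF this] obtain N \<delta> where N: "N > 0" and \<delta>: "\<delta> > 0" and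
      close: "\<And>t \<tau>. (\<And>s. 0 < s \<Longrightarrow> s \<le> N \<Longrightarrow> norm (f (t - s + \<tau>) - f (t - s)) \<le> \<delta>) \<Longrightarrow>
        norm (?F (t + \<tau>) - ?F t) \<le> e / 2" by blast
    \<comment> \<open>This interval contains \<open>t - s\<close> and \<open>t' - s\<close> whenever
      \<open>0 < s \<le> N\<close> and \<open>\<bar>t' - t\<bar> < 1\<close>.\<close>
    have "uniformly_continuous_on {t - N - 1..t + 1} f"
      by (intro compact_uniformly_continuous continuous_on_subset[OF f]) auto
    then obtain d where d: "d > 0" "\<And>x y. x \<in> {t - N - 1..t + 1} \<Longrightarrow> y \<in> {t - N - 1..t + 1} \<Longrightarrow>
        dist y x < d \<Longrightarrow> dist (f y) (f x) < \<delta>"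
      using \<delta> unfolding uniformly_continuous_on_def by metis
    have "dist (?F t') (?F t) < e" if t': "dist t' t < min d 1" for t'
    proof -
      have "norm (f (t - s + (t' - t)) - f (t - s)) \<le> \<delta>" if "0 < s" "s \<le> N" for s
      proof -
        have "dist (f (t - s + (t' - t))) (f (t - s)) < \<delta>"
          by (rule d(2)) (use that t' in \<open>auto simp: dist_real_def\<close>)
        then show ?thesis by (simp add: dist_norm)
      qed
      from close[OF this] show ?thesis
        using \<open>e > 0\<close> by (simp add: dist_norm)
    qed
    then show "\<exists>d>0. \<forall>t'. dist t' t < d \<longrightarrow> dist (?F t') (?F t) < e"
      using d(1) by (intro exI[of _ "min d 1"]) auto
  qed
  moreover have "bounded (range ?F)"
  proof -
    have "norm (?F t) \<le> integral {0<..} (\<lambda>s. norm (R s) * C)" for t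
      unfolding form(4)
    proof (intro integral_norm_bound_integral form(1) integrable_on_mult_left int)
      show "norm (R s (f (t - s))) \<le> norm (R s) * C" for s
        using norm_blinfun[of "R s" "f (t - s)"] mult_left_mono[OF C[of "t - s"] norm_ge_zero[of "R s"]]
        by linarith
    qed
    then show ?thesis
      by (auto simp: bounded_iff)
  qed
  moreover have "\<exists>L>0. \<forall>a. \<exists>\<tau>\<in>{a<..<a + L}. \<exists>M>0.
        \<forall>t. \<bar>t\<bar> \<ge> M \<longrightarrow> norm (?F (t + \<tau>) - ?F t) \<le> \<epsilon>" if "\<epsilon> > 0" for \<epsilon>
  proof -
    from small[OF that] obtain N \<delta> where N: "N > 0" and \<delta>: "\<delta> > 0" and
      close: "\<And>t \<tau>. (\<And>s. 0 < s \<Longrightarrow> s \<le> N \<Longrightarrow> norm (f (t - s + \<tau>) - f (t - s)) \<le> \<delta>) \<Longrightarrow>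
        norm (?F (t + \<tau>) - ?F t) \<le> \<epsilon>" by blast
    \<comment> \<open>The length belonging to \<open>f\<close> and \<delta> serves for the
      convolution and \<epsilon>, with the same \<tau>; only \<open>M\<close> grows, to
      \<open>M + N\<close>.\<close>
    obtain L where L: "L > 0" "\<And>a. \<exists>\<tau>\<in>{a<..<a + L}. \<exists>M>0.
        \<forall>t. \<bar>t\<bar> \<ge> M \<longrightarrow> norm (f (t + \<tau>) - f t) \<le> \<delta>"
      using aap[OF \<delta>] by blast
    have "\<exists>\<tau>\<in>{a<..<a + L}. \<exists>M>0. \<forall>t. \<bar>t\<bar> \<ge> M \<longrightarrow> norm (?F (t + \<tau>) - ?F t) \<le> \<epsilon>" for a
    proof -
      obtain \<tau> M where \<tau>: "\<tau> \<in> {a<..<a + L}" and M: "M > 0"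
        "\<And>t. \<bar>t\<bar> \<ge> M \<Longrightarrow> norm (f (t + \<tau>) - f t) \<le> \<delta>"
        using L(2) by blast
      have "norm (?F (t + \<tau>) - ?F t) \<le> \<epsilon>" if "\<bar>t\<bar> \<ge> M + N" for t
        by (intro close M(2)) (use that in linarith)
      then show ?thesis
        using \<tau> M(1) N by (intro bexI[of _ \<tau>] exI[of _ "M + N"]) auto
    qed
    then show ?thesis
      using L(1) by blast
  qed
  ultimately show ?thesis
    using form(2,3) by (auto simp: Q_AAP_def)
qed

end
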